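(* Let $A$ be an $n\times n$ complex matrix, let $\Sigma_1$ be an $n\times k$ complex matrix with orthonormal columns and let $\Sigma_2$ be a $k\times r$ complex matrix with orthonormal columns. Then $\Sigma_1\Sigma_2$ has orthonormal columns and $$\mathcal{R}(\lambda,\Sigma_1\Sigma_2,A)=\mathcal{R}\left(\lambda,\Sigma_2,\mathcal{R}(\lambda,\Sigma_1,A)\right).$$
   Context: For a constant complex matrix $\Sigma$ with orthonormal columns and a square matrix $B$ (with as many rows as $\Sigma$) whose entries are complex numbers, or more generally rational functions $p(\lambda)/q(\lambda)$ with complex coefficients and $\deg p\le\deg q$, the generalized isospectral reduction of $B$ with respect to $\Sigma$ is $\mathcal{R}(\lambda,\Sigma,B)=\lambda I-\left(\Sigma^*(\lambda I-B)^{-1}\Sigma\right)^{-1}$, a matrix of rational functions in $\lambda$. Here $\Sigma^*$ is the conjugate transpose, and $\lambda$ is a formal variable. *)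

theory Defs
  imports "HOL-Analysis.Analysis" "HOL-Computational_Algebra.Computational_Algebra"
begin

type_synonym ratfun = "complex poly fract"

definition ratfun_var :: ratfun
  where "ratfun_var = to_fract [:0, 1:]"

definition const_matrix :: "complex ^ 'm ^ 'n \<Rightarrow> ratfun ^ 'm ^ 'n"
  where "const_matrix = map_matrix (\<lambda>c. to_fract [:c:])"

definition conj_transpose :: "complex ^ 'm ^ 'n \<Rightarrow> complex ^ 'n ^ 'm"
  where "conj_transpose S = (\<chi> i j. cnj (S $ j $ i))"

text \<open>The columns are orthonormal for the Hermitian inner product. The library's
  inner product on \<open>complex ^ 'n\<close> is its real part only, hence the explicit sum.\<close>

definition orthonormal_columns :: "complex ^ 'm ^ 'n \<Rightarrow> bool"
  where "orthonormal_columns S \<longleftrightarrow>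
    (\<forall>i j. (\<Sum>l\<in>UNIV. cnj (S $ l $ i) * S $ l $ j) = (if i = j then 1 else 0))"

text \<open>The zero function is included, as \<open>Fract 0 1\<close>.\<close>

definition proper_ratfun :: "ratfun \<Rightarrow> bool"
  where "proper_ratfun f \<longleftrightarrow>
    (\<exists>p q. q \<noteq> 0 \<and> degree p \<le> degree q \<and> f = Fract p q)"

definition proper_matrix :: "ratfun ^ 'm ^ 'n \<Rightarrow> bool"
  where "proper_matrix B \<longleftrightarrow> (\<forall>i j. proper_ratfun (B $ i $ j))"

text \<open>In the next two definitions \<open>mat x\<close> is \<open>x\<close> times the identity matrix.\<close>

definition compressed_resolvent :: "complex ^ 'k ^ 'n \<Rightarrow> ratfun ^ 'n ^ 'n \<Rightarrow> ratfun ^ 'k ^ 'k"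
  where "compressed_resolvent S B =
    const_matrix (conj_transpose S) ** matrix_inv (mat ratfun_var - B) ** const_matrix S"

definition isospectral_reduction :: "complex ^ 'k ^ 'n \<Rightarrow> ratfun ^ 'n ^ 'n \<Rightarrow> ratfun ^ 'k ^ 'k"
  where "isospectral_reduction S B = mat ratfun_var - matrix_inv (compressed_resolvent S B)"

text \<open>\<open>matrix_inv\<close> is total, with an unspecified value at a singular matrix.
  The following says that \<open>B\<close> has admissible entries and that both inverses in
  \<open>isospectral_reduction S B\<close> are genuine ones.\<close>

definition reduction_defined :: "complex ^ 'k ^ 'n \<Rightarrow> ratfun ^ 'n ^ 'n \<Rightarrow> bool"
  where "reduction_defined S B \<longleftrightarrow>
    proper_matrix B \<and> invertible (mat ratfun_var - B) \<and> invertible (compressed_resolvent S B)"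

end

theory Submission
  imports Defs
begin

unbundle no Formal_Power_Series.fps_syntax  \<comment> \<open>its \<open>$\<close> clashes with vector indexing\<close>

text \<open>The matrix \<open>\<lambda>I - \<R>(\<lambda>, S1, A)\<close> is the inverse of the compression of the resolvent of
  \<open>A\<close> to \<open>S1\<close>. Compressing its inverse to \<open>S2\<close> is therefore the same as compressing the
  resolvent of \<open>A\<close> to \<open>S1 ** S2\<close>, which gives the identity once all inverses exist.

  For existence, the proper rational functions form a valuation ring in which \<open>t = 1/\<lambda>\<close> is not
  a unit. For proper \<open>B\<close>, the matrix \<open>I - tB\<close> has an inverse of the form \<open>I + tC\<close> with \<open>C\<close>
  proper. Since \<open>\<lambda>I - B = \<lambda>(I - tB)\<close> and \<open>S\<^sup>*S = I\<close>, the compressed resolvent is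
  \<open>t(I - tE)\<close> with \<open>E = -S\<^sup>*CS\<close> proper, so it is invertible with inverse \<open>\<lambda>I + D\<close> for a
  proper \<open>D\<close>, and \<open>\<R>(\<lambda>, S, B) = -D\<close> is again proper.\<close>

subsection \<open>The valuation ring of proper rational functions\<close>

lemma proper_ratfunI: "q \<noteq> 0 \<Longrightarrow> degree p \<le> degree q \<Longrightarrow> proper_ratfun (Fract p q)"
  unfolding proper_ratfun_def by blast

lemma proper_ratfun_const [simp]: "proper_ratfun (to_fract [:c:])"
  unfolding to_fract_def by (rule proper_ratfunI) auto

lemma proper_ratfun_0 [simp]: "proper_ratfun 0"
  using proper_ratfun_const[of 0] by simp

lemma proper_ratfun_1 [simp]: "proper_ratfun 1"
  using proper_ratfun_const[of 1] by (simp flip: one_pCons)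

lemma proper_ratfun_add: 
  assumes "proper_ratfun f" "proper_ratfun g"
  shows "proper_ratfun (f + g)"
proof -
  from assms obtain p q p' q' where *: "q \<noteq> 0" "degree p \<le> degree q" "f = Fract p q"
      "q' \<noteq> 0" "degree p' \<le> degree q'" "g = Fract p' q'"
    unfolding proper_ratfun_def by blast
  have "degree (p * q') \<le> degree q + degree q'" "degree (p' * q) \<le> degree q + degree q'"
    using * degree_mult_le[of p q'] degree_mult_le[of p' q] by linarith+
  then have "degree (p * q' + p' * q) \<le> degree (q * q')"
    using * by (simp add: degree_mult_eq degree_add_le)
  with * show ?thesis by (simp add: proper_ratfunI)
qed

lemma proper_ratfun_mult:
  assumes "proper_ratfun f" "proper_ratfun g"
  shows "proper_ratfun (f * g)"
proof -
  from assms obtain p q p' q' where *: "q \<noteq> 0" "degree p \<le> degree q" "f = Fract p q"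
      "q' \<noteq> 0" "degree p' \<le> degree q'" "g = Fract p' q'"
    unfolding proper_ratfun_def by blast
  have "degree (p * p') \<le> degree (q * q')"
    using * degree_mult_le[of p p'] by (simp add: degree_mult_eq)
  with * show ?thesis by (simp add: proper_ratfunI)
qed

lemma proper_ratfun_uminus [simp]: "proper_ratfun (- f) \<longleftrightarrow> proper_ratfun f"
proof -
  have "proper_ratfun (- f)" if f: "proper_ratfun f" for f
  proof -
    from f obtain p q where "q \<noteq> 0" "degree p \<le> degree q" "f = Fract p q"
      unfolding proper_ratfun_def by blast
    then show ?thesis using proper_ratfunI[of q "- p"] by simp
  qed
  from this[of f] this[of "- f"] show ?thesis by auto
qed

lemma proper_ratfun_sum:
  "(\<And>i. i \<in> I \<Longrightarrow> proper_ratfun (f i)) \<Longrightarrow> proper_ratfun (sum f I)"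
  by (induction I rule: infinite_finite_induct) (auto intro: proper_ratfun_add)

text \<open>The valuation is a difference of degrees, and any two degrees are comparable. Quotients
  by zero are 0, hence proper.\<close>

lemma proper_ratfun_divide_total: "proper_ratfun (f / g) \<or> proper_ratfun (g / f)"
proof -
  have "proper_ratfun h \<or> proper_ratfun (inverse h)" for h :: ratfun
  proof (cases h)
    case (Fract p q)
    show ?thesis
    proof (cases "p = 0")
      case True
      then have "h = 0" using Fract by (simp add: Zero_fract_def eq_fract)
      then show ?thesis by simp
    next
      case False
      then show ?thesis
        using Fract proper_ratfunI[of q p] proper_ratfunI[of p q] linear[of "degree p" "degree q"]
        by auto
    qed
  qed
  from this[of "f / g"] show ?thesis by simp
qed

lemma ratfun_var_nonzero [simp]: "ratfun_var \<noteq> 0"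
  unfolding ratfun_var_def by simp

text \<open>Over the denominator \<open>d\<close>, of degree one more than \<open>q\<close>, the
  numerator \<open>d - p\<close> keeps the degree of \<open>d\<close>, so the fraction is a unit of
  the valuation ring.\<close>

lemma one_minus_proper_div_var:
  assumes "proper_ratfun s"
  shows "1 - s / ratfun_var \<noteq> 0" "proper_ratfun (inverse (1 - s / ratfun_var))"
proof -
  from assms obtain p q where pq: "q \<noteq> 0" "degree p \<le> degree q" "s = Fract p q"
    unfolding proper_ratfun_def by blast
  define d where "d = [:0, 1:] * q"
  have d: "d \<noteq> 0" "degree p < degree d"
    using pq by (auto simp: d_def degree_mult_eq)
  have eq: "1 - s / ratfun_var = Fract (d - p) d"
    using pq d by (simp add: d_def ratfun_var_def to_fract_def One_fract_def eq_fract algebra_simps)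
  have deg: "degree (d - p) = degree d"
    using d degree_add_eq_left[of "- p" d] by simp
  then have "d - p \<noteq> 0" using d by force
  then show "1 - s / ratfun_var \<noteq> 0"
    using d by (simp add: eq Zero_fract_def eq_fract)
  show "proper_ratfun (inverse (1 - s / ratfun_var))"
    using d deg \<open>d - p \<noteq> 0\<close> by (simp add: eq proper_ratfunI)
qed

text \<open>Since any two entries are comparable, the finite nonempty set of nonzero entries has a
  maximum. Zero entries are set aside first: quotients by them are 0, which would break
  transitivity.\<close>

lemma exists_dominating_entry:
  fixes x :: "ratfun ^ 'n"
  assumes "x \<noteq> 0"
  obtains i where "x $ i \<noteq> 0" "\<And>j. proper_ratfun (x $ j / x $ i)"
proof -
  have ex: "I \<noteq> {} \<Longrightarrow> (\<And>i. i \<in> I \<Longrightarrow> x $ i \<noteq> 0) \<Longrightarrow> \<exists>i\<in>I. \<forall>j\<in>I. proper_ratfun (x $ j / x $ i)"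
    if "finite I" for I
    using that
  proof (induction I rule: finite_induct)
    case (insert a I)
    show ?case
    proof (cases "I = {}")
      case False
      with insert obtain i where i: "i \<in> I" "\<forall>j\<in>I. proper_ratfun (x $ j / x $ i)" by auto
      have nz: "x $ i \<noteq> 0" "x $ a \<noteq> 0" using insert.prems i by auto
      consider "proper_ratfun (x $ a / x $ i)" | "proper_ratfun (x $ i / x $ a)"
        using proper_ratfun_divide_total by blast
      then show ?thesis
      proof cases
        case 1
        with i show ?thesis by auto
      next
        case 2
        \<comment> \<open>Transitivity: the product of \<open>x $ j / x $ i\<close> and
          \<open>x $ i / x $ a\<close> is \<open>x $ j / x $ a\<close>, so \<open>a\<close> takes
          over as the maximum.\<close>
        have "proper_ratfun (x $ j / x $ a)" if "j \<in> I" for j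
          using proper_ratfun_mult[OF i(2)[rule_format, OF that] 2] nz by simp
        then show ?thesis using nz by auto
      qed
    qed (use insert in auto)
  qed auto
  have "{i. x $ i \<noteq> 0} \<noteq> {}"
    using assms by (auto simp: vec_eq_iff)
  then have "\<exists>i\<in>{i. x $ i \<noteq> 0}. \<forall>j\<in>{i. x $ i \<noteq> 0}. proper_ratfun (x $ j / x $ i)"
    by (intro ex) auto
  then obtain i where i: "x $ i \<noteq> 0" "\<And>j. x $ j \<noteq> 0 \<Longrightarrow> proper_ratfun (x $ j / x $ i)"
    by blast
  show thesis
  proof (rule that[OF i(1)])
    show "proper_ratfun (x $ j / x $ i)" for j
      using i(2)[of j] by (cases "x $ j = 0") auto
  qed
qed

section \<open>Matrices of proper functions and matrix identities\<close>

lemma proper_matrix_mult: "proper_matrix A \<Longrightarrow> proper_matrix B \<Longrightarrow> proper_matrix (A ** B)"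
  unfolding proper_matrix_def matrix_matrix_mult_def
  by (auto intro!: proper_ratfun_sum proper_ratfun_mult)

lemma proper_matrix_const: "proper_matrix (const_matrix A)"
  by (simp add: proper_matrix_def const_matrix_def)

lemma proper_matrix_uminus: "proper_matrix (- A) \<longleftrightarrow> proper_matrix A"
  by (simp add: proper_matrix_def)

lemma mat_mult_component: "(mat c ** M) $ i $ j = c * M $ i $ j"
  by (simp add: matrix_matrix_mult_def mat_def if_distrib[where f = "\<lambda>x. x * _"] sum.delta cong: if_cong)

lemma mat_mult_commute:
  fixes M :: "'a::comm_ring_1 ^ 'm ^ 'n"
  shows "M ** mat c = mat c ** M"
  by (simp add: vec_eq_iff mat_mult_component)
    (simp add: matrix_matrix_mult_def mat_def if_distrib sum.delta mult.commute cong: if_cong)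

lemma mat_mult_mat: "mat c ** mat d = (mat (c * d) :: 'a::comm_ring_1 ^ 'n ^ 'n)"
  by (simp add: vec_eq_iff mat_mult_component) (simp add: mat_def)

lemma matrix_diff_ldistrib: "A ** (B - C) = A ** B - A ** (C :: 'a::comm_ring_1 ^ 'p ^ 'm)"
  by (simp add: vec_eq_iff matrix_matrix_mult_def right_diff_distrib sum_subtractf)

lemma matrix_diff_rdistrib: "(A - B) ** C = A ** C - B ** (C :: 'a::comm_ring_1 ^ 'p ^ 'm)"
  by (simp add: vec_eq_iff matrix_matrix_mult_def left_diff_distrib sum_subtractf)

lemma matrix_add_rdistrib: "(A + B) ** C = A ** C + B ** (C :: 'a::comm_ring_1 ^ 'p ^ 'm)"
  by (simp add: vec_eq_iff matrix_matrix_mult_def distrib_right sum.distrib)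

lemma matrix_inv_eqI:
  fixes A B :: "'a::field ^ 'n ^ 'n"
  assumes "A ** B = mat 1"
  shows "invertible A" "matrix_inv A = B"
proof -
  show "invertible A" using assms invertible_right_inverse by blast
  then have "A ** matrix_inv A = mat 1"
    unfolding matrix_inv_def invertible_def by (rule someI2_ex) simp
  then show "matrix_inv A = B"
    by (metis assms matrix_left_right_inverse matrix_mul_assoc matrix_mul_lid matrix_mul_rid)
qed

text \<open>Dividing the \<open>k\<close>-th equation by an entry \<open>x $ k\<close> of maximal valuation turns it into
  \<open>y $ k = x $ k * u\<close> with a unit \<open>u\<close> of the ring of proper functions.\<close>

lemma resolvent_vector_bound:
  fixes B :: "ratfun ^ 'n ^ 'n" and x y :: "ratfun ^ 'n"
  assumes B: "proper_matrix B"
    and eq: "\<And>i. x $ i - (\<Sum>j\<in>UNIV. B $ i $ j * x $ j) / ratfun_var = y $ i"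
    and y: "\<And>i. proper_ratfun (y $ i)"
  shows "proper_ratfun (x $ i)" and "y = 0 \<Longrightarrow> x = 0"
proof -
  \<comment> \<open>One pivot settles both claims: properness is trivial for \<open>x = 0\<close>,
    and \<open>y \<noteq> 0\<close> gives the second claim by contraposition.\<close>
  have *: "(\<forall>i. proper_ratfun (x $ i)) \<and> y \<noteq> 0" if "x \<noteq> 0"
  proof -
    obtain k where k: "x $ k \<noteq> 0" "\<And>j. proper_ratfun (x $ j / x $ k)"
      using exists_dominating_entry[OF \<open>x \<noteq> 0\<close>] by metis
    define s where "s = (\<Sum>j\<in>UNIV. B $ k $ j * (x $ j / x $ k))"
    have s: "proper_ratfun s"
      unfolding s_def using B k(2)
      by (intro proper_ratfun_sum proper_ratfun_mult) (auto simp: proper_matrix_def)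
    have "(\<Sum>j\<in>UNIV. B $ k $ j * x $ j) = s * x $ k"
      using k(1) by (simp add: s_def sum_distrib_right)
    then have yk: "y $ k = x $ k * (1 - s / ratfun_var)"
      using eq[of k] by (simp add: algebra_simps)
    note u = one_minus_proper_div_var[OF s]
    have "x $ k = y $ k * inverse (1 - s / ratfun_var)"
      using u(1) yk by simp
    then have "proper_ratfun (x $ k)"
      using u(2) y[of k] by (metis proper_ratfun_mult)
    then have "proper_ratfun (x $ j)" for j
      using proper_ratfun_mult[OF k(2)[of j]] k(1) by (metis nonzero_eq_divide_eq)
    moreover have "y $ k \<noteq> 0" using yk u(1) k(1) by simp
    ultimately show ?thesis by (auto simp: vec_eq_iff)
  qed
  then show "proper_ratfun (x $ i)" by (cases "x = 0") auto
  show "y = 0 \<Longrightarrow> x = 0" using * by blast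
qed

text \<open>The inverse N of I - tB satisfies N = I + tBN, so C = BN serves. This closed form
  replaces the Neumann series, and no convergence question arises.\<close>

lemma proper_neumann_inverse:
  fixes B :: "ratfun ^ 'n ^ 'n"
  assumes B: "proper_matrix B"
  obtains C where "proper_matrix C"
    "(mat 1 - mat (inverse ratfun_var) ** B) ** (mat 1 + mat (inverse ratfun_var) ** C) = mat 1"
proof -
  define t where "t = inverse ratfun_var"
  define M where "M = mat 1 - mat t ** B"
  have M_nth: "M $ i $ j = (if i = j then 1 else 0) - t * B $ i $ j" for i j
    by (simp add: M_def mat_mult_component) (simp add: mat_def)
  have M_sum: "(\<Sum>j\<in>UNIV. M $ i $ j * f j) = f i - (\<Sum>j\<in>UNIV. B $ i $ j * f j) / ratfun_var" for i f
  proof -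
    have "(\<Sum>j\<in>UNIV. M $ i $ j * f j)
        = (\<Sum>j\<in>UNIV. (if i = j then f j else 0) - B $ i $ j * f j / ratfun_var)"
      by (intro sum.cong) (auto simp: M_nth t_def field_simps)
    then show ?thesis by (simp add: sum_subtractf sum_divide_distrib)
  qed
  have ker: "x = 0" if "M *v x = 0" for x
  proof (rule resolvent_vector_bound(2)[OF B, of x 0])
    show "x $ i - (\<Sum>j\<in>UNIV. B $ i $ j * x $ j) / ratfun_var = 0 $ i" for i
      using that by (simp flip: M_sum add: vec_eq_iff matrix_vector_mult_def)
  qed auto
  have "\<exists>N. N ** M = mat 1"
    unfolding matrix_left_invertible_ker using ker by (intro allI impI)
  then obtain N where "N ** M = mat 1" ..
  then have MN: "M ** N = mat 1" by (rule matrix_left_right_inverse1)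
  have "proper_ratfun (N $ i $ j)" for i j
  proof -
    \<comment> \<open>Column \<open>j\<close> of \<open>N\<close> solves Mx = e_j, whose right-hand
      side has entries 0 and 1, so the vector bound applies.\<close>
    have "proper_ratfun ((\<chi> i. N $ i $ j) $ i)"
    proof (rule resolvent_vector_bound(1)[OF B])
      show "(\<chi> i. N $ i $ j) $ i - (\<Sum>l\<in>UNIV. B $ i $ l * (\<chi> i. N $ i $ j) $ l) / ratfun_var
          = (\<chi> i. (M ** N) $ i $ j) $ i" for i
        by (simp add: matrix_matrix_mult_def M_sum)
    qed (simp add: MN mat_def)
    then show ?thesis by simp
  qed
  then have "proper_matrix N" by (simp add: proper_matrix_def)
  then have "proper_matrix (B ** N)" by (rule proper_matrix_mult[OF B])
  moreover have "mat 1 + mat t ** (B ** N) = N"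
    using MN by (simp add: M_def matrix_diff_rdistrib matrix_mul_assoc diff_eq_eq)
  then have "M ** (mat 1 + mat t ** (B ** N)) = mat 1"
    using MN by (simp only:)
  ultimately show thesis
    unfolding M_def t_def by (rule that)
qed

subsection \<open>Constant matrices\<close>

lemma const_matrix_mult:
  fixes A :: "complex ^ 'b ^ 'a" and B :: "complex ^ 'c ^ 'b"
  shows "const_matrix (A ** B) = const_matrix A ** const_matrix B"
proof -
  have add: "to_fract [:a + b:] = to_fract [:a:] + to_fract [:b:]" for a b :: complex
    by (simp flip: to_fract_add)
  have "to_fract [:sum f I:] = (\<Sum>i\<in>I. to_fract [:f i:])" for f :: "'b \<Rightarrow> complex" and I
    by (induction I rule: infinite_finite_induct) (simp_all add: add)
  moreover have "to_fract [:a * b:] = to_fract [:a:] * to_fract [:b:]" for a b :: complex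
    by (simp flip: to_fract_mult)
  ultimately show ?thesis
    by (simp add: vec_eq_iff const_matrix_def matrix_matrix_mult_def)
qed

lemma const_matrix_1: "const_matrix (mat 1) = mat 1"
  by (simp add: vec_eq_iff const_matrix_def mat_def flip: one_pCons)

lemma conj_transpose_mult: "conj_transpose (A ** B) = conj_transpose B ** conj_transpose A"
  by (simp add: vec_eq_iff conj_transpose_def matrix_matrix_mult_def mult.commute)

lemma orthonormal_columns_iff: "orthonormal_columns S \<longleftrightarrow> conj_transpose S ** S = mat 1"
  by (simp add: vec_eq_iff orthonormal_columns_def conj_transpose_def matrix_matrix_mult_def mat_def)

lemma orthonormal_columns_mult:
  assumes "orthonormal_columns S1" "orthonormal_columns S2"
  shows "orthonormal_columns (S1 ** S2)"
  using assms unfolding orthonormal_columns_iff conj_transpose_mult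
  by (metis matrix_mul_assoc matrix_mul_lid)

subsection \<open>The isospectral reduction\<close>

text \<open>The Neumann inverse is used twice, for \<open>B\<close> and for its compression
  \<open>E\<close>. Preservation of properness is what lets the result be applied again to an
  iterated reduction.\<close>

lemma reduction_proper:
  fixes B :: "ratfun ^ 'n ^ 'n" and S :: "complex ^ 'k ^ 'n"
  assumes S: "orthonormal_columns S" and B: "proper_matrix B"
  shows reduction_defined_proper: "reduction_defined S B"
    and proper_isospectral_reduction: "proper_matrix (isospectral_reduction S B)"
proof -
  define t where "t = inverse ratfun_var"
  have t: "mat ratfun_var ** mat t = (mat 1 :: ratfun ^ 'n ^ 'n)"
    by (simp add: mat_mult_mat t_def)
  obtain C where C: "proper_matrix C" "(mat 1 - mat t ** B) ** (mat 1 + mat t ** C) = mat 1"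
    unfolding t_def by (rule proper_neumann_inverse[OF B])
  have fac: "mat ratfun_var - B = mat ratfun_var ** (mat 1 - mat t ** B)"
    by (simp add: matrix_diff_ldistrib matrix_mul_assoc t)
  have "(mat ratfun_var - B) ** ((mat 1 + mat t ** C) ** mat t)
      = mat ratfun_var ** ((mat 1 - mat t ** B) ** (mat 1 + mat t ** C)) ** mat t"
    by (simp only: fac matrix_mul_assoc)
  also have "\<dots> = mat 1" by (simp add: C(2) t)
  finally have inv: "(mat ratfun_var - B) ** ((mat 1 + mat t ** C) ** mat t) = mat 1" .
  note inv = matrix_inv_eqI[OF inv]
  define T where "T = const_matrix (conj_transpose S)"
  \<comment> \<open>The sign gives I + tT\<open>C\<close>S, with S constant, the shape I -
    t\<open>E\<close> to which the Neumann inverse applies.\<close>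
  define E where "E = - (T ** C ** const_matrix S)"
  have E: "proper_matrix E"
    unfolding E_def T_def proper_matrix_uminus
    by (intro proper_matrix_mult proper_matrix_const C(1))
  have TS: "T ** const_matrix S = mat 1"
    using S unfolding T_def orthonormal_columns_iff by (metis const_matrix_mult const_matrix_1)
  have "compressed_resolvent S B = T ** ((mat 1 + mat t ** C) ** mat t) ** const_matrix S"
    by (simp add: compressed_resolvent_def inv(2) T_def)
  \<comment> \<open>The scalar matrix \<open>mat t\<close> passes from size n to size k as it moves
    across \<open>const_matrix S\<close>, and likewise across \<open>T\<close> below.\<close>
  also have "\<dots> = T ** (mat 1 + mat t ** C) ** const_matrix S ** mat t"
    by (metis mat_mult_commute matrix_mul_assoc)
  also have "T ** (mat 1 + mat t ** C) ** const_matrix S = mat 1 + T ** mat t ** C ** const_matrix S"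
    by (simp add: matrix_add_ldistrib matrix_add_rdistrib TS matrix_mul_assoc)
  also have "T ** mat t ** C ** const_matrix S = mat t ** T ** C ** const_matrix S"
    by (simp only: mat_mult_commute[of T])
  also have "mat 1 + mat t ** T ** C ** const_matrix S = mat 1 - mat t ** E"
    by (simp add: E_def vec_eq_iff mat_mult_component matrix_mul_assoc flip: matrix_mul_assoc)
  finally have K: "compressed_resolvent S B = (mat 1 - mat t ** E) ** mat t" .
  obtain D where D: "proper_matrix D" "(mat 1 - mat t ** E) ** (mat 1 + mat t ** D) = mat 1"
    unfolding t_def by (rule proper_neumann_inverse[OF E])
  \<comment> \<open>Thus \<lambda>I + \<open>D\<close> inverts the compressed resolvent, and the
    reduction equals -\<open>D\<close>.\<close>
  have "mat t ** (mat ratfun_var + D) = mat 1 + mat t ** D"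
    by (simp add: matrix_add_ldistrib mat_mult_mat t_def)
  then have "compressed_resolvent S B ** (mat ratfun_var + D) = mat 1"
    using D(2) by (simp add: K flip: matrix_mul_assoc)
  note K_inv = matrix_inv_eqI[OF this]
  show "reduction_defined S B"
    using B inv(1) K_inv(1) by (simp add: reduction_defined_def)
  show "proper_matrix (isospectral_reduction S B)"
    using D(1) by (simp add: isospectral_reduction_def K_inv(2) proper_matrix_uminus)
qed

lemma matrix_inv_matrix_inv:
  fixes A :: "'a::field ^ 'n ^ 'n"
  assumes "invertible A"
  shows "matrix_inv (matrix_inv A) = A"
proof -
  from assms obtain B where "A ** B = mat 1" "B ** A = mat 1"
    unfolding invertible_def by blast
  then show ?thesis using matrix_inv_eqI(2) by metis
qed

text \<open>Subtracting the reduction from \<lambda>I leaves the inverse of the compressed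
  resolvent; inverting once more recovers it because it is invertible, as
  \<open>reduction_defined\<close> guarantees.\<close>

lemma compressed_resolvent_mult:
  assumes "reduction_defined S1 B"
  shows "compressed_resolvent S2 (isospectral_reduction S1 B) = compressed_resolvent (S1 ** S2) B"
  using assms
  by (simp add: reduction_defined_def compressed_resolvent_def[of S2] isospectral_reduction_def
      matrix_inv_matrix_inv)
    (simp add: compressed_resolvent_def const_matrix_mult conj_transpose_mult matrix_mul_assoc)

theorem theorem2p17:
  fixes A :: "complex ^ 'n ^ 'n"
    and S1 :: "complex ^ 'k ^ 'n"
    and S2 :: "complex ^ 'r ^ 'k"
  assumes "orthonormal_columns S1"
    and "orthonormal_columns S2"
  shows "orthonormal_columns (S1 ** S2)
    \<and> reduction_defined (S1 ** S2) (const_matrix A)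
    \<and> reduction_defined S1 (const_matrix A)
    \<and> reduction_defined S2 (isospectral_reduction S1 (const_matrix A))
    \<and> isospectral_reduction (S1 ** S2) (const_matrix A)
        = isospectral_reduction S2 (isospectral_reduction S1 (const_matrix A))"
proof -
  note A = proper_matrix_const[of A]
  note S = orthonormal_columns_mult[OF assms]
  note S1 = reduction_proper[OF assms(1) A]
  \<comment> \<open>Both sides are \<lambda>I minus the inverse of the same compressed
    resolvent.\<close>
  have "isospectral_reduction (S1 ** S2) (const_matrix A)
        = isospectral_reduction S2 (isospectral_reduction S1 (const_matrix A))"
    using compressed_resolvent_mult[OF S1(1), of S2]
    by (simp add: isospectral_reduction_def[of "S1 ** S2"] isospectral_reduction_def[of S2])
  then show ?thesis
    using S S1(1) reduction_defined_proper[OF S A] reduction_defined_proper[OF assms(2) S1(2)]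
    by blast
qed

end
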